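(* Consider the stochastic APP recursion described in the context, under all the assumptions listed there. Then, for all $k\in\mathbb{N}$, the set-valued mapping $M_k:\Omega\rightrightarrows\mathbb{U}$ that defines the $k$-th iteration of the stochastic APP algorithm admits a measurable selection.
   Context: Setting and assumptions. $\mathbb{U}$ is a reflexive separable Banach space with dual $\mathbb{U}^\star$ (dual norm topology, Borel $\sigma$-fields on both), $\langle\cdot,\cdot\rangle$ is the duality pairing; $(\Omega,\mathcal{A},\mathbb{P})$ is a probability space with $\mathcal{A}$ complete for $\mathbb{P}$; $\mathbb{W}$ is a topological vector space with its Borel $\sigma$-field; $U^{\mathrm{ad}}\subset\mathbb{U}$ is non-empty, closed and convex. $j^{C},j^{\Sigma}:\mathbb{U}\times\mathbb{W}\to\mathbb{R}$ are jointly lower semicontinuous and, for all $w\in\mathbb{W}$, $j^{C}(\cdot,w)$ and $j^{\Sigma}(\cdot,w)$ are proper and convex; moreover $j^{C}(\cdot,w)$ is subdifferentiable on an open set containing $U^{\mathrm{ad}}$. $K:\mathbb{U}\to\mathbb{R}$ is proper, convex, lower semicontinuous, and Gateaux-differentiable (with linear bounded directional derivative) on an open set containing $U^{\mathrm{ad}}$. $\mathbf{W}_1,\mathbf{W}_2,\ldots:\Omega\to\mathbb{W}$ are measurable (independent, identically distributed random variables); $\mathbf{R}_k:\Omega\to\mathbb{U}^\star$, $k\in\mathbb{N}$, are measurable; $\varepsilon_k>0$ for all $k\in\mathbb{N}$; $u_0\in U^{\mathrm{ad}}$. Stochastic APP recursion. $M_0(\omega)=\{u_0\}$ for all $\omega$.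 For $k\in\mathbb{N}$, given a measurable selection $\mathbf{U}_k:\Omega\to U^{\mathrm{ad}}$ of $M_k$, let $\mathbf{G}_k:\Omega\to\mathbb{U}^\star$ be a measurable mapping with $\mathbf{G}_k(\omega)\in\partial_u j^{C}(\mathbf{U}_k(\omega),\mathbf{W}_{k+1}(\omega))$ for all $\omega$ (such a mapping exists under the present assumptions), and set $$M_{k+1}(\omega)=\operatorname*{arg\,min}_{u\in U^{\mathrm{ad}}}\;K(u)+\big\langle\varepsilon_k(\mathbf{G}_k(\omega)+\mathbf{R}_k(\omega))-\nabla K(\mathbf{U}_k(\omega)),u\big\rangle+\varepsilon_k\,j^{\Sigma}(u,\mathbf{W}_{k+1}(\omega)).$$ It is assumed that at every iteration $k$ and for all $\omega$ the function of $u$ being minimized is coercive on $U^{\mathrm{ad}}$ (it tends to $+\infty$ when $\|u\|\to+\infty$, $u\in U^{\mathrm{ad}}$). A measurable selection of a set-valued mapping $\Gamma:\Omega\rightrightarrows\mathbb{U}$ is a measurable $\gamma:\Omega\to\mathbb{U}$ with $\gamma(\omega)\in\Gamma(\omega)$ for all $\omega$. $\partial_u$ denotes the convex subdifferential in $u$ over all of $\mathbb{U}$. *)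

theory Defs
  imports "HOL-Probability.Probability"
begin

text \<open>Real topological vector spaces; no separation axiom is imposed.\<close>

class topological_real_vector = real_vector + topological_ab_group_add +
  assumes tendsto_scaleR_Pair:
    "LIM x (nhds a \<times>\<^sub>F nhds b). fst x *\<^sub>R snd x :> nhds (a *\<^sub>R b)"

instance real_normed_vector \<subseteq> topological_real_vector
  by standard (intro tendsto_intros filterlim_fst filterlim_snd)

text \<open>
  The dual of \<open>'u\<close> is the normed space \<open>'u \<Rightarrow>\<^sub>L real\<close>, the duality pairing of \<open>g\<close> and \<open>u\<close>
  being \<open>blinfun_apply g u\<close>.  Reflexivity is surjectivity of the canonical embedding
  into the bidual.
\<close>

definition reflexive_space :: "'u::real_normed_vector itself \<Rightarrow> bool" where
  "reflexive_space _ \<longleftrightarrow>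
     (\<forall>F :: ('u \<Rightarrow>\<^sub>L real) \<Rightarrow>\<^sub>L real. \<exists>u. \<forall>g. blinfun_apply F g = blinfun_apply g u)"

definition lower_semicontinuous :: "('a::topological_space \<Rightarrow> 'b::linorder) \<Rightarrow> bool" where
  "lower_semicontinuous f \<longleftrightarrow> (\<forall>x. \<forall>c < f x. \<forall>\<^sub>F y in nhds x. c < f y)"

definition proper_fun :: "('a \<Rightarrow> ereal) \<Rightarrow> bool" where
  "proper_fun f \<longleftrightarrow> (\<exists>x. f x < \<infinity>) \<and> (\<forall>x. - \<infinity> < f x)"

definition subdifferential ::
    "('u::real_normed_vector \<Rightarrow> real) \<Rightarrow> 'u \<Rightarrow> ('u \<Rightarrow>\<^sub>L real) set" where
  "subdifferential f u = {g. \<forall>v. f v \<ge> f u + blinfun_apply g (v - u)}"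

definition has_gateaux_derivative ::
    "('u::real_normed_vector \<Rightarrow> real) \<Rightarrow> ('u \<Rightarrow>\<^sub>L real) \<Rightarrow> 'u \<Rightarrow> bool" where
  "has_gateaux_derivative f g u \<longleftrightarrow>
     (\<forall>h. ((\<lambda>t. (f (u + t *\<^sub>R h) - f u) / t) \<longlongrightarrow> blinfun_apply g h) (at 0))"

definition gateaux_gradient ::
    "('u::real_normed_vector \<Rightarrow> real) \<Rightarrow> 'u \<Rightarrow> ('u \<Rightarrow>\<^sub>L real)" where
  "gateaux_gradient f u = (THE g. has_gateaux_derivative f g u)"

text \<open>
  \<open>f u\<close> tends to plus infinity as the norm of \<open>u\<close> tends to infinity with \<open>u \<in> S\<close>;
  the condition is vacuous for bounded \<open>S\<close>.
\<close>

definition coercive_on :: "'u::real_normed_vector set \<Rightarrow> ('u \<Rightarrow> real) \<Rightarrow> bool" where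
  "coercive_on S f \<longleftrightarrow> filterlim f at_top (inf at_infinity (principal S))"

definition argmin_on :: "'u set \<Rightarrow> ('u \<Rightarrow> real) \<Rightarrow> 'u set" where
  "argmin_on S f = {u. is_arg_min f (\<lambda>v. v \<in> S) u}"

definition measurable_selection ::
    "'a measure \<Rightarrow> ('a \<Rightarrow> 'u::topological_space set) \<Rightarrow> ('a \<Rightarrow> 'u) \<Rightarrow> bool" where
  "measurable_selection P \<Gamma> \<gamma> \<longleftrightarrow> \<gamma> \<in> borel_measurable P \<and> (\<forall>\<omega>\<in>space P. \<gamma> \<omega> \<in> \<Gamma> \<omega>)"

text \<open>
  The function of \<open>v\<close> minimized in one APP step, for the current iterate \<open>u\<close>, subgradient \<open>g\<close>,
  perturbation \<open>r\<close>, step size \<open>e\<close> and noise value \<open>w\<close>.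
\<close>

definition app_objective ::
    "('u::real_normed_vector \<Rightarrow> real) \<Rightarrow> ('u \<Rightarrow> 'w \<Rightarrow> real) \<Rightarrow> real \<Rightarrow>
     'u \<Rightarrow> ('u \<Rightarrow>\<^sub>L real) \<Rightarrow> ('u \<Rightarrow>\<^sub>L real) \<Rightarrow> 'w \<Rightarrow> 'u \<Rightarrow> real" where
  "app_objective K jS e u g r w v =
     K v + blinfun_apply (e *\<^sub>R (g + r) - gateaux_gradient K u) v + e * jS v w"

end

theory Submission
  imports Defs
begin

text \<open>
  A minimizer of a coercive convex function on a closed convex set exists because reflexivity
  makes bounded closed convex sets weakly compact; the point is to choose it measurably in
  \<open>\<omega>\<close>.  Convexity makes this elementary.  By the Baire category theorem a real-valued convex
  lower semicontinuous function on a Banach space is continuous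
  (\<open>convex_lower_semicontinuous_imp_continuous\<close>), so the objective \<open>F \<omega> u\<close> of one step is
  continuous in \<open>u\<close> and measurable in \<open>\<omega>\<close>.  Let \<open>S\<close> be the feasible set and \<open>C\<close> any closed
  convex set meeting it.  The minimum of \<open>F \<omega>\<close> over \<open>C \<inter> S\<close> is attained too, hence the minimizers over \<open>S\<close>
  meet \<open>C\<close> if and only if the infima over \<open>C \<inter> S\<close> and over \<open>S\<close> coincide.  By continuity these
  infima can be computed over countable dense subsets, so the set of those \<open>\<omega>\<close> for which the
  minimizers meet \<open>C\<close> is measurable.
  
  This is all that the Kuratowski--Ryll-Nardzewski construction needs: intersecting the
  minimizer sets successively with closed balls of radius \<open>2\<^sup>-\<^sup>n\<close> around points of a dense sequence
  involves only closed convex sets, and leaves one point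
  (\<open>convex_hit_measurable_imp_selection\<close>, \<open>argmin_measurable_selection\<close>).
  
  The existence of minimizers (\<open>convex_coercive_attains_inf\<close>) rests on the intersection theorem
  \<open>reflexive_bounded_convex_chain_Inter\<close> for chains of bounded closed convex sets.
  It uses the Hahn--Banach theorem twice: on the dual, to find a functional below all support
  functions of the chain, which reflexivity represents by a point; and on the space itself, to
  separate this point from any member of the chain that would not contain it.
  
  The measurability of the objective in \<open>\<omega>\<close> comes from pairing everything with a fixed
  \<open>v\<close>.  In particular the gradient pairing is a limit of difference quotients of the
  continuous function \<open>K\<close>.  The theorem follows by induction on \<open>k\<close>.
\<close>

section \<open>Sublinear functions and Hahn--Banach separation\<close>

definition sublinear :: "('a::real_vector \<Rightarrow> real) \<Rightarrow> bool" where
  "sublinear p \<longleftrightarrow> (\<forall>x y. p (x + y) \<le> p x + p y) \<and> (\<forall>c\<ge>0. \<forall>x. p (c *\<^sub>R x) = c * p x)"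

lemma sublinearI:
  assumes "\<And>x y. p (x + y) \<le> p x + p y"
    and zero: "p 0 = 0"
    and scale: "\<And>c x. c > 0 \<Longrightarrow> p (c *\<^sub>R x) \<le> c * p x"
  shows "sublinear p"
  unfolding sublinear_def
proof (intro conjI allI impI)
  fix c :: real and x assume "c \<ge> 0"
  show "p (c *\<^sub>R x) = c * p x"
  proof (cases "c = 0")
    case False
    then have c: "c > 0" using \<open>c \<ge> 0\<close> by simp
    have "p ((1 / c) *\<^sub>R (c *\<^sub>R x)) \<le> (1 / c) * p (c *\<^sub>R x)"
      by (rule scale) (use c in simp)
    then have "c * p x \<le> p (c *\<^sub>R x)" using c by (simp add: field_simps)
    with scale[OF c, of x] show ?thesis by simp
  qed (simp add: zero)
qed (rule assms)

lemma
  assumes "sublinear p"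
  shows sublinear_add: "p (x + y) \<le> p x + p y"
    and sublinear_scale: "c \<ge> 0 \<Longrightarrow> p (c *\<^sub>R x) = c * p x"
    and sublinear_zero: "p 0 = 0"
    and sublinear_minus: "- p (- x) \<le> p x"
proof -
  show *: "p (x + y) \<le> p x + p y" for x y using assms by (simp add: sublinear_def)
  show **: "c \<ge> 0 \<Longrightarrow> p (c *\<^sub>R x) = c * p x" for c x using assms by (simp add: sublinear_def)
  show ***: "p 0 = 0" using **[of 0 0] by simp
  show "- p (- x) \<le> p x" using *[of x "- x"] *** by simp
qed

text \<open>
  The chain property gives subadditivity, since two members can be replaced by the smaller one.
  The lemma provides the lower bounds for Zorn's lemma in the Hahn--Banach theorem, and it applies
  to the support functions of a chain of sets.
\<close>

lemma sublinear_INF_chain: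
  assumes ne: "F \<noteq> {}"
    and sub: "\<And>f. f \<in> F \<Longrightarrow> sublinear f"
    and chain: "\<And>f g. f \<in> F \<Longrightarrow> g \<in> F \<Longrightarrow> f \<le> g \<or> g \<le> f"
    and bdd: "\<And>x. bdd_below ((\<lambda>f. f x) ` F)"
  shows "sublinear (\<lambda>x. INF f\<in>F. f x)"
proof (rule sublinearI)
  let ?q = "\<lambda>x. INF f\<in>F. f x"
  have low: "?q x \<le> f x" if "f \<in> F" for f x
    by (rule cINF_lower[OF bdd that])
  show "?q (x + y) \<le> ?q x + ?q y" for x y
  proof -
    have *: "?q (x + y) - f x \<le> g y" if fg: "f \<in> F" "g \<in> F" for f g
    proof -
      obtain h where h: "h \<in> F" "h \<le> f" "h \<le> g"
        using chain[OF fg] fg by blast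
      have "?q (x + y) \<le> h (x + y)" by (rule low[OF h(1)])
      also have "\<dots> \<le> h x + h y" by (rule sublinear_add[OF sub[OF h(1)]])
      also have "\<dots> \<le> f x + g y" using h(2,3) by (auto simp: le_fun_def intro: add_mono)
      finally show ?thesis by linarith
    qed
    have **: "?q (x + y) - f x \<le> ?q y" if "f \<in> F" for f
      by (rule cINF_greatest[OF ne]) (rule *[OF that])
    have *: "?q (x + y) - ?q y \<le> f x" if "f \<in> F" for f using **[OF that] by linarith
    have "?q (x + y) - ?q y \<le> ?q x"
      by (rule cINF_greatest[OF ne]) (rule *)
    then show ?thesis by linarith
  qed
  have "(\<lambda>f. f 0) ` F = {0}" using ne sublinear_zero[OF sub] by (auto simp: image_iff)
  then show "?q 0 = 0" by simp
  show "?q (c *\<^sub>R x) \<le> c * ?q x" if c: "c > 0" for c x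
  proof -
    have "?q (c *\<^sub>R x) / c \<le> ?q x"
    proof (rule cINF_greatest[OF ne])
      fix f assume f: "f \<in> F"
      have "?q (c *\<^sub>R x) \<le> c * f x"
        using low[OF f, of "c *\<^sub>R x"] sublinear_scale[OF sub[OF f], of c x] c by simp
      then show "?q (c *\<^sub>R x) / c \<le> f x" using c by (simp add: field_simps)
    qed
    then show ?thesis using c by (simp add: field_simps)
  qed
qed

text \<open>
  The witness \<open>q x = inf\<^bsub>t\<ge>0\<^esub> (p (x + t y) - t p y)\<close> is the one-sided derivative of \<open>p\<close> at \<open>y\<close> in the
  direction \<open>x\<close>, written with \<open>t\<close> as the reciprocal of the step.  If \<open>p\<close> cannot be decreased,
  then \<open>q = p\<close> and the last clause becomes \<open>p x + p y \<le> p (x + y)\<close>, which makes \<open>p\<close> additive.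
\<close>

lemma sublinear_directional:
  fixes p :: "'a::real_vector \<Rightarrow> real"
  assumes p: "sublinear p"
  shows "\<exists>q. sublinear q \<and> q \<le> p \<and> (\<forall>x. q x \<le> p (x + y) - p y)"
proof -
  define q where "q x = (INF t\<in>{0..}. p (x + t *\<^sub>R y) - t * p y)" for x
  have ne: "{0::real..} \<noteq> {}" by auto
  have lb: "- p (- x) \<le> p (x + t *\<^sub>R y) - t * p y" if "t \<ge> 0" for t x
    using sublinear_add[OF p, of "x + t *\<^sub>R y" "- x"] sublinear_scale[OF p that, of y] by simp
  have bdd: "bdd_below ((\<lambda>t. p (x + t *\<^sub>R y) - t * p y) ` {0..})" for x
    by (rule bdd_belowI2[of _ "- p (- x)"]) (use lb in auto)
  have low: "q x \<le> p (x + t *\<^sub>R y) - t * p y" if "t \<ge> 0" for x t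
    unfolding q_def by (rule cINF_lower[OF bdd]) (use that in simp)
  have "sublinear q"
  proof (rule sublinearI)
    show "q (x + z) \<le> q x + q z" for x z
    proof -
      have *: "q (x + z) \<le> (p (x + t *\<^sub>R y) - t * p y) + (p (z + s *\<^sub>R y) - s * p y)"
        if "t \<ge> 0" "s \<ge> 0" for t s
        using low[of "t + s" "x + z"] that sublinear_add[OF p, of "x + t *\<^sub>R y" "z + s *\<^sub>R y"]
        by (simp add: algebra_simps)
      have "q (x + z) - (p (x + t *\<^sub>R y) - t * p y) \<le> q z" if "t \<ge> 0" for t
        unfolding q_def[of z] by (rule cINF_greatest[OF ne]) (use *[OF that] in \<open>force simp: algebra_simps\<close>)
      then have "q (x + z) - q z \<le> q x"
        unfolding q_def[of x] by (intro cINF_greatest[OF ne]) (force simp: algebra_simps)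
      then show ?thesis by simp
    qed
    show "q 0 = 0"
      unfolding q_def using sublinear_scale[OF p, of _ y] by (simp cong: INF_cong_simp)
    show "q (c *\<^sub>R x) \<le> c * q x" if c: "c > 0" for c x
    proof -
      have "q (c *\<^sub>R x) / c \<le> q x"
        unfolding q_def[of x]
      proof (rule cINF_greatest[OF ne])
        fix t :: real assume t: "t \<in> {0..}"
        have "q (c *\<^sub>R x) \<le> p (c *\<^sub>R (x + t *\<^sub>R y)) - (c * t) * p y"
          using low[of "c * t" "c *\<^sub>R x"] c t by (simp add: algebra_simps)
        also have "\<dots> = c * (p (x + t *\<^sub>R y) - t * p y)"
          using sublinear_scale[OF p, of c "x + t *\<^sub>R y"] c by (simp add: algebra_simps)
        finally show "q (c *\<^sub>R x) / c \<le> p (x + t *\<^sub>R y) - t * p y"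
          using c by (simp add: field_simps)
      qed
      then show ?thesis using c by (simp add: field_simps)
    qed
  qed
  moreover have "q \<le> p" using low[of 0] by (auto simp: le_fun_def)
  moreover have "q x \<le> p (x + y) - p y" for x using low[of 1 x] by simp
  ultimately show ?thesis by blast
qed

text \<open>
  The Hahn--Banach theorem.  By Zorn's lemma there is a minimal sublinear function below \<open>p\<close>,
  and minimality against \<open>sublinear_directional\<close> forces it to be linear.
\<close>

lemma sublinear_dominates_linear:
  fixes p :: "'a::real_vector \<Rightarrow> real"
  assumes p: "sublinear p"
  shows "\<exists>f. linear f \<and> (\<forall>x. f x \<le> p x)"
proof -
  define A where "A = {q. sublinear q \<and> q \<le> p}"
  have "\<exists>m\<in>A. \<forall>a\<in>A. a \<le> m \<longrightarrow> a = m"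
  proof (rule predicate_Zorn)
    show "partial_order_on A (relation_of (\<lambda>x y. y \<le> x) A)"
      by (rule partial_order_on_relation_ofI) auto
    fix C assume C: "C \<in> Chains (relation_of (\<lambda>x y. y \<le> x) A)"
    have CA: "C \<subseteq> A" using C unfolding Chains_def relation_of_def by auto
    have chain: "f \<le> g \<or> g \<le> f" if "f \<in> C" "g \<in> C" for f g
      using C that unfolding Chains_def relation_of_def by auto
    show "\<exists>u\<in>A. \<forall>a\<in>C. u \<le> a"
    proof (cases "C = {}")
      case True
      then show ?thesis using p by (auto simp: A_def)
    next
      case False
      have "- p (- x) \<le> f x" if "f \<in> C" for f x
      proof -
        have "sublinear f" "f (- x) \<le> p (- x)" using that CA by (auto simp: A_def le_fun_def)
        with sublinear_minus[of f x] show ?thesis by simp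
      qed
      then have bdd: "bdd_below ((\<lambda>f. f x) ` C)" for x by (rule bdd_belowI2)
      define u where "u x = (INF f\<in>C. f x)" for x
      have "sublinear u"
        unfolding u_def by (rule sublinear_INF_chain[OF False _ chain bdd]) (use CA in \<open>auto simp: A_def\<close>)
      moreover have low: "u \<le> f" if "f \<in> C" for f
        unfolding u_def le_fun_def by (intro allI cINF_lower[OF bdd that])
      moreover have "u \<le> p"
      proof -
        obtain f where "f \<in> C" using False by blast
        with low CA show ?thesis by (auto simp: A_def dest: order_trans[of u f p])
      qed
      ultimately show ?thesis by (auto simp: A_def)
    qed
  qed
  then obtain m where m: "sublinear m" "m \<le> p"
    and min: "\<And>q. sublinear q \<Longrightarrow> q \<le> m \<Longrightarrow> q = m"
    unfolding A_def by (blast intro: order_trans)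
  have add: "m (x + y) = m x + m y" for x y
  proof -
    obtain q where "sublinear q" "q \<le> m" "\<forall>x. q x \<le> m (x + y) - m y"
      using sublinear_directional[OF m(1)] by blast
    with min have "m x \<le> m (x + y) - m y" by blast
    with sublinear_add[OF m(1), of x y] show ?thesis by simp
  qed
  have neg: "m (- x) = - m x" for x
    using add[of x "- x"] sublinear_zero[OF m(1)] by simp
  have "linear m"
  proof (rule linearI)
    show "m (r *\<^sub>R x) = r *\<^sub>R m x" for r x
    proof (cases "r \<ge> 0")
      case False
      then have "m ((- r) *\<^sub>R x) = - r * m x" by (intro sublinear_scale[OF m(1)]) simp
      then show ?thesis using neg[of "(- r) *\<^sub>R x"] by simp
    qed (simp add: sublinear_scale[OF m(1)])
  qed (rule add)
  with m(2) show ?thesis by (auto simp: le_fun_def)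
qed

lemma linear_le_norm_imp_blinfun:
  fixes f :: "'u::real_normed_vector \<Rightarrow> real"
  assumes f: "linear f" and le: "\<And>x. f x \<le> R * norm x"
  shows "\<exists>g :: 'u \<Rightarrow>\<^sub>L real. blinfun_apply g = f"
proof -
  have "bounded_linear f"
  proof (rule bounded_linear_intro[where K = R])
    show "f (x + y) = f x + f y" "f (r *\<^sub>R x) = r *\<^sub>R f x" for x y r
      using f by (simp_all add: linear_add linear_scale)
    show "norm (f x) \<le> norm x * R" for x
      using le[of x] le[of "- x"] linear_neg[OF f, of x] by (simp add: abs_le_iff mult.commute)
  qed
  then show ?thesis by (metis bounded_linear_Blinfun_apply)
qed

text \<open>
  The function \<open>p y = inf (norm (y + t c) - t \<delta>)\<close> over \<open>t \<ge> 0\<close> and \<open>c \<in> C\<close> is sublinear because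
  \<open>C\<close> is convex, it is finite because \<open>\<delta> \<le> norm c\<close>, and it satisfies \<open>p y \<le> norm y\<close> and
  \<open>p (- c) \<le> - \<delta>\<close>.  Every linear function below \<open>p\<close> is therefore bounded and separates.
\<close>

lemma convex_separation_from_origin:
  fixes C :: "'u::real_normed_vector set"
  assumes C: "convex C" "C \<noteq> {}" and d: "\<delta> \<ge> 0" "\<And>c. c \<in> C \<Longrightarrow> \<delta> \<le> norm c"
  shows "\<exists>g :: 'u \<Rightarrow>\<^sub>L real. \<forall>c\<in>C. \<delta> \<le> blinfun_apply g c"
proof -
  define T where "T = {0::real..} \<times> C"
  define \<phi> where "\<phi> y = (\<lambda>(t, c). norm (y + t *\<^sub>R c) - t * \<delta>)" for y :: 'u
  define p where "p y = (INF z\<in>T. \<phi> y z)" for y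
  have ne: "T \<noteq> {}" using C(2) by (auto simp: T_def)
  have lb: "- norm y \<le> \<phi> y z" if z: "z \<in> T" for y z
  proof -
    obtain t c where [simp]: "z = (t, c)" and t: "t \<ge> 0" and c: "c \<in> C" using z by (auto simp: T_def)
    have "t * \<delta> \<le> norm (t *\<^sub>R c)" using d(2)[OF c] t by (simp add: mult_left_mono)
    also have "\<dots> \<le> norm (y + t *\<^sub>R c) + norm y" using norm_triangle_ineq4[of "y + t *\<^sub>R c" y] by simp
    finally show ?thesis by (simp add: \<phi>_def)
  qed
  have bdd: "bdd_below (\<phi> y ` T)" for y by (rule bdd_belowI2) (rule lb)
  have low: "p y \<le> \<phi> y z" if "z \<in> T" for y z
    unfolding p_def by (rule cINF_lower[OF bdd that])
  obtain c0 where c0: "c0 \<in> C" using C(2) by blast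
  have le_norm: "p y \<le> norm y" for y
    using low[of "(0, c0)" y] c0 by (simp add: T_def \<phi>_def)
  have "sublinear p"
  proof (rule sublinearI)
    show "p (x + y) \<le> p x + p y" for x y
    proof -
      have *: "p (x + y) \<le> \<phi> x z + \<phi> y w" if zw_T: "z \<in> T" "w \<in> T" for z w
      proof -
        obtain t c s e where zw: "z = (t, c)" "w = (s, e)" and t: "t \<ge> 0" "s \<ge> 0" and c: "c \<in> C" "e \<in> C"
          using zw_T by (auto simp: T_def)
        obtain b where b: "b \<in> C" "(t + s) *\<^sub>R b = t *\<^sub>R c + s *\<^sub>R e"
        proof (cases "t + s = 0")
          case True
          then have "t = 0" "s = 0" using t by auto
          then show ?thesis using that c by simp
        next
          case False
          then have pos: "t + s > 0" using t by simp
          have "(t / (t + s)) *\<^sub>R c + (s / (t + s)) *\<^sub>R e \<in> C"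
            by (rule convexD[OF C(1) c]) (use pos t in \<open>auto simp: add_divide_distrib[symmetric]\<close>)
          then show ?thesis using that pos by (simp add: scaleR_right_distrib)
        qed
        have "p (x + y) \<le> \<phi> (x + y) (t + s, b)" by (rule low) (use t b in \<open>simp add: T_def\<close>)
        also have "\<dots> = norm ((x + t *\<^sub>R c) + (y + s *\<^sub>R e)) - (t + s) * \<delta>"
          by (simp only: \<phi>_def prod.case b(2)) (simp add: add_ac)
        also have "\<dots> \<le> \<phi> x z + \<phi> y w"
          using norm_triangle_ineq[of "x + t *\<^sub>R c" "y + s *\<^sub>R e"] by (simp add: \<phi>_def zw algebra_simps)
        finally show ?thesis .
      qed
      have "p (x + y) - \<phi> x z \<le> p y" if "z \<in> T" for z
        unfolding p_def[of y] by (rule cINF_greatest[OF ne]) (use *[OF that] in \<open>simp add: algebra_simps\<close>)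
      then have "p (x + y) - p y \<le> p x"
        unfolding p_def[of x] by (intro cINF_greatest[OF ne]) (simp add: algebra_simps)
      then show ?thesis by simp
    qed
    have "0 \<le> p 0" unfolding p_def by (rule cINF_greatest[OF ne]) (use lb[of _ 0] in simp)
    with le_norm[of 0] show "p 0 = 0" by simp
    show "p (c *\<^sub>R x) \<le> c * p x" if c: "c > 0" for c x
    proof -
      have "p (c *\<^sub>R x) / c \<le> p x"
        unfolding p_def[of x]
      proof (rule cINF_greatest[OF ne])
        fix z assume "z \<in> T"
        then obtain t b where z: "z = (t, b)" "t \<ge> 0" "b \<in> C" by (auto simp: T_def)
        have "p (c *\<^sub>R x) \<le> \<phi> (c *\<^sub>R x) (c * t, b)" by (rule low) (use z c in \<open>simp add: T_def\<close>)
        also have "\<dots> = norm (c *\<^sub>R (x + t *\<^sub>R b)) - c * t * \<delta>" by (simp add: \<phi>_def scaleR_right_distrib)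
        also have "\<dots> = c * \<phi> x z" using c unfolding norm_scaleR by (simp add: \<phi>_def z algebra_simps)
        finally show "p (c *\<^sub>R x) / c \<le> \<phi> x z" using c by (simp add: field_simps)
      qed
      then show ?thesis using c by (simp add: field_simps)
    qed
  qed
  then obtain f where f: "linear f" "\<And>x. f x \<le> p x"
    using sublinear_dominates_linear by blast
  obtain g where g: "blinfun_apply g = f"
    using linear_le_norm_imp_blinfun[OF f(1), of 1] order_trans[OF f(2) le_norm] by auto
  have "\<delta> \<le> blinfun_apply g c" if "c \<in> C" for c
    using low[of "(1, c)" "- c"] f(2)[of "- c"] that linear_neg[OF f(1), of c]
    by (simp add: T_def \<phi>_def g)
  then show ?thesis by blast
qed

lemma closed_convex_point_separation:
  fixes C :: "'u::real_normed_vector set"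
  assumes C: "closed C" "convex C" "C \<noteq> {}" and x: "x \<notin> C"
  shows "\<exists>(g :: 'u \<Rightarrow>\<^sub>L real) \<delta>. \<delta> > 0 \<and> (\<forall>c\<in>C. blinfun_apply g c + \<delta> \<le> blinfun_apply g x)"
proof -
  obtain \<delta> where \<delta>: "\<delta> > 0" "ball x \<delta> \<subseteq> - C"
    using C(1) x open_contains_ball[of "- C"] by (auto simp: closed_def)
  then have \<delta>_le: "\<delta> \<le> dist x c" if "c \<in> C" for c
    using that by (auto simp: not_less[symmetric])
  have "convex ((\<lambda>c. x - c) ` C)"
    using convex_linear_image[OF linear_uminus C(2)] convex_translation[of "uminus ` C" x]
    by (simp add: image_image)
  then obtain g where g: "\<And>c. c \<in> C \<Longrightarrow> \<delta> \<le> blinfun_apply g (x - c)"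
    using convex_separation_from_origin[of "(\<lambda>c. x - c) ` C" \<delta>] C(3) \<delta>(1) \<delta>_le by (auto simp: dist_norm)
  have "blinfun_apply g c + \<delta> \<le> blinfun_apply g x" if "c \<in> C" for c
    using g[OF that] by (simp add: blinfun.diff_right)
  then show ?thesis using \<delta>(1) by (intro exI[of _ g] exI[of _ \<delta>]) simp
qed

section \<open>Minimizers of convex functions on reflexive spaces\<close>

text \<open>
  The infimum of the support functions \<open>\<sigma> C g = sup\<^bsub>x\<in>C\<^esub> g x\<close> is a sublinear function on the dual,
  finite because every member of the chain meets a fixed bounded member.  A linear functional
  below it is bounded, hence by reflexivity the evaluation at some \<open>x\<close>, and \<open>g x \<le> \<sigma> C g\<close> for
  all \<open>g\<close> places \<open>x\<close> in the closed convex set \<open>C\<close>.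
\<close>

lemma reflexive_bounded_convex_chain_Inter:
  fixes \<C> :: "'u::real_normed_vector set set"
  assumes refl: "reflexive_space TYPE('u)"
    and ne: "\<C> \<noteq> {}"
    and \<C>: "\<And>C. C \<in> \<C> \<Longrightarrow> C \<noteq> {} \<and> closed C \<and> convex C \<and> bounded C"
    and chain: "\<And>C D. C \<in> \<C> \<Longrightarrow> D \<in> \<C> \<Longrightarrow> C \<subseteq> D \<or> D \<subseteq> C"
  shows "\<Inter>\<C> \<noteq> {}"
proof -
  define \<sigma> where "\<sigma> C g = (SUP x\<in>C. blinfun_apply g x)" for C :: "'u set" and g :: "'u \<Rightarrow>\<^sub>L real"
  obtain C0 where C0: "C0 \<in> \<C>" using ne by blast
  then obtain R where R: "\<And>x. x \<in> C0 \<Longrightarrow> norm x \<le> R"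
    using \<C>[OF C0] by (auto simp: bounded_iff)
  have bdd: "bdd_above (blinfun_apply g ` C)" if C: "C \<in> \<C>" for C and g :: "'u \<Rightarrow>\<^sub>L real"
  proof -
    obtain B where B: "\<And>x. x \<in> C \<Longrightarrow> norm x \<le> B" using \<C>[OF C] by (auto simp: bounded_iff)
    have "blinfun_apply g x \<le> norm g * B" if "x \<in> C" for x
      using norm_blinfun[of g x] mult_left_mono[OF B[OF that], of "norm g"] by simp
    then show ?thesis by (rule bdd_aboveI2)
  qed
  have up: "blinfun_apply g x \<le> \<sigma> C g" if "C \<in> \<C>" "x \<in> C" for C g x
    unfolding \<sigma>_def by (rule cSUP_upper[OF that(2) bdd[OF that(1)]])
  have least: "\<sigma> C g \<le> b" if "C \<in> \<C>" "\<And>x. x \<in> C \<Longrightarrow> blinfun_apply g x \<le> b" for C g b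
    unfolding \<sigma>_def using \<C>[OF that(1)] that(2) by (intro cSUP_least) auto
  have sub: "sublinear (\<sigma> C)" if C: "C \<in> \<C>" for C
  proof (rule sublinearI)
    show "\<sigma> C (g + h) \<le> \<sigma> C g + \<sigma> C h" for g h
      by (rule least[OF C]) (auto simp: blinfun.add_left intro!: add_mono up[OF C])
    show "\<sigma> C 0 = 0" using \<C>[OF C] by (simp add: \<sigma>_def)
    show "\<sigma> C (c *\<^sub>R g) \<le> c * \<sigma> C g" if "c > 0" for c g
      by (rule least[OF C]) (use that in \<open>auto simp: blinfun.scaleR_left intro!: mult_left_mono up[OF C]\<close>)
  qed
  have lower: "- (R * norm g) \<le> \<sigma> C g" if C: "C \<in> \<C>" for C g
  proof -
    obtain x where x: "x \<in> C" "x \<in> C0" using chain[OF C C0] \<C>[OF C] \<C>[OF C0] by blast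
    have "- (R * norm g) \<le> blinfun_apply g x"
      using norm_blinfun[of g x] mult_left_mono[OF R[OF x(2)], of "norm g"] by (simp add: mult.commute)
    also have "\<dots> \<le> \<sigma> C g" by (rule up[OF C x(1)])
    finally show ?thesis .
  qed
  have bddb: "bdd_below ((\<lambda>f. f g) ` \<sigma> ` \<C>)" for g
    by (rule bdd_belowI[of _ "- (R * norm g)"]) (use lower in auto)
  have "sublinear (\<lambda>g. INF f\<in>\<sigma> ` \<C>. f g)"
  proof (rule sublinear_INF_chain[OF _ _ _ bddb])
    have mono: "\<sigma> C \<le> \<sigma> D" if "C \<in> \<C>" "D \<in> \<C>" "C \<subseteq> D" for C D
      unfolding le_fun_def by (intro allI least[OF that(1)] up[OF that(2)]) (use that in auto)
    fix f h assume "f \<in> \<sigma> ` \<C>" "h \<in> \<sigma> ` \<C>"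
    then obtain C D where "f = \<sigma> C" "h = \<sigma> D" "C \<in> \<C>" "D \<in> \<C>" by auto
    then show "f \<le> h \<or> h \<le> f" using chain[of C D] mono[of C D] mono[of D C] by auto
  qed (use ne sub in auto)
  then obtain F where F: "linear F" "\<And>g. F g \<le> (INF f\<in>\<sigma> ` \<C>. f g)"
    using sublinear_dominates_linear by blast
  have F_le: "F g \<le> \<sigma> C g" if "C \<in> \<C>" for C g
    using F(2)[of g] cINF_lower[OF bddb, of "\<sigma> C" g] that by auto
  have "F g \<le> R * norm g" for g
  proof -
    have "\<sigma> C0 g \<le> R * norm g"
    proof (rule least[OF C0])
      show "blinfun_apply g x \<le> R * norm g" if "x \<in> C0" for x
        using norm_blinfun[of g x] mult_left_mono[OF R[OF that], of "norm g"] by (simp add: mult.commute)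
    qed
    with F_le[OF C0, of g] show ?thesis by simp
  qed
  then obtain F' where "blinfun_apply F' = F" using linear_le_norm_imp_blinfun[OF F(1), of R] by blast
  moreover obtain x where "\<forall>g. blinfun_apply F' g = blinfun_apply g x"
    using refl unfolding reflexive_space_def by blast
  ultimately have x: "F g = blinfun_apply g x" for g by simp
  have "x \<in> C" if C: "C \<in> \<C>" for C
  proof (rule ccontr)
    assume "x \<notin> C"
    then obtain g :: "'u \<Rightarrow>\<^sub>L real" and \<delta> where \<delta>: "\<delta> > 0" "\<forall>c\<in>C. blinfun_apply g c + \<delta> \<le> blinfun_apply g x"
      using closed_convex_point_separation[of C x] \<C>[OF C] by blast
    have "\<sigma> C g \<le> blinfun_apply g x - \<delta>"
      by (rule least[OF C]) (use \<delta>(2) in \<open>simp add: le_diff_eq\<close>)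
    with F_le[OF C, of g] x[of g] \<delta>(1) show False by simp
  qed
  then show ?thesis by blast
qed

text \<open>
  The minimizers are the common points of the sublevel sets \<open>{x\<in>C. f x \<le> f y}\<close>, \<open>y \<in> C\<close>,
  which form a chain of bounded closed convex sets.
\<close>

lemma convex_coercive_attains_inf:
  fixes f :: "'u::real_normed_vector \<Rightarrow> real"
  assumes refl: "reflexive_space TYPE('u)"
    and C: "closed C" "convex C" "C \<noteq> {}"
    and f: "convex_on UNIV f" "continuous_on UNIV f"
    and bdd: "\<And>b. bounded {x\<in>C. f x \<le> b}"
  shows "\<exists>x\<in>C. \<forall>y\<in>C. f x \<le> f y"
proof -
  define S where "S y = {x\<in>C. f x \<le> f y}" for y
  have "\<Inter>(S ` C) \<noteq> {}"
  proof (rule reflexive_bounded_convex_chain_Inter[OF refl])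
    show "S ` C \<noteq> {}" using C(3) by simp
    show "D \<noteq> {} \<and> closed D \<and> convex D \<and> bounded D" if D: "D \<in> S ` C" for D
    proof -
      obtain y where y: "y \<in> C" "D = S y" using D by blast
      have D_eq: "D = C \<inter> {x. f x \<le> f y}" by (auto simp: y(2) S_def)
      have "convex {x. f x \<le> f y}"
      proof (rule convexI)
        fix a b and u v :: real
        assume "a \<in> {x. f x \<le> f y}" "b \<in> {x. f x \<le> f y}" and uv: "0 \<le> u" "0 \<le> v" "u + v = 1"
        then have ab: "f a \<le> f y" "f b \<le> f y" by auto
        have "f (u *\<^sub>R a + v *\<^sub>R b) \<le> u * f a + v * f b" using f(1) uv by (simp add: convex_on_def)
        also have "\<dots> \<le> f y" by (rule convex_bound_le[OF ab uv])
        finally show "u *\<^sub>R a + v *\<^sub>R b \<in> {x. f x \<le> f y}" by simp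
      qed
      moreover have "closed {x. f x \<le> f y}"
        using f(2) by (intro closed_Collect_le continuous_on_const)
      moreover have "y \<in> D" "bounded D" using y bdd[of "f y"] by (simp_all add: S_def)
      ultimately show ?thesis using C by (auto simp: D_eq intro: convex_Int closed_Int)
    qed
    show "D \<subseteq> E \<or> E \<subseteq> D" if DE: "D \<in> S ` C" "E \<in> S ` C" for D E
    proof -
      obtain y z where "D = S y" "E = S z" using DE by blast
      then show ?thesis by (cases "f y \<le> f z") (auto simp: S_def)
    qed
  qed
  then show ?thesis using C(3) by (auto simp: S_def)
qed

section \<open>Continuity of convex lower semicontinuous functions\<close>

lemma lower_semicontinuous_open_superlevel:
  assumes "lower_semicontinuous f"
  shows "open {x. c < f x}"
  using assms unfolding lower_semicontinuous_def
  by (subst open_subopen) (force simp: eventually_nhds)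

text \<open>
  The closed sublevel sets at integer heights cover the space, so by Baire \<open>f\<close> is bounded above
  on some ball.  Convexity carries this bound to a ball around every other point, and a convex
  function that is locally bounded above is continuous.
\<close>

lemma convex_lower_semicontinuous_imp_continuous:
  fixes f :: "'u::banach \<Rightarrow> real"
  assumes conv: "convex_on UNIV f" and lsc: "lower_semicontinuous f"
  shows "continuous_on UNIV f"
proof -
  define L where "L n = {x. f x \<le> real n}" for n :: nat
  have "- L n = {x. real n < f x}" for n by (auto simp: L_def)
  then have closed: "closed (L n)" for n
    using lower_semicontinuous_open_superlevel[OF lsc, of "real n"] by (simp add: closed_def)
  have Un: "(\<Union>n. L n) = UNIV" using real_arch_simple by (auto simp: L_def)
  have "\<exists>n. interior (L n) \<noteq> {}"
  proof (rule ccontr)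
    assume "\<not> ?thesis"
    then have "euclidean interior_of (\<Union>(range L)) = {}"
      using closed by (intro Baire_category_alt) (auto simp: completely_metrizable_space_euclidean)
    then show False by (simp add: Un)
  qed
  then obtain n z where "z \<in> interior (L n)" by blast
  then obtain e where e: "e > 0" "ball z e \<subseteq> L n" by (meson mem_interior)
  have "continuous (at x) f" for x
  proof -
    \<comment> \<open>\<open>x\<close> is the midpoint of \<open>z\<close> and \<open>w\<close>, so points near \<open>x\<close> are midpoints of \<open>w\<close> and points near \<open>z\<close>.\<close>
    define w where "w = 2 *\<^sub>R x - z"
    define b where "b = real n / 2 + f w / 2"
    have up: "f y \<le> b" if "y \<in> cball x (e/4)" for y
    proof -
      have "2 *\<^sub>R y - w - z = 2 *\<^sub>R (y - x)" by (simp add: w_def scaleR_2 algebra_simps)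
      then have "dist (2 *\<^sub>R y - w) z = 2 * dist y x" by (simp add: dist_norm)
      then have "2 *\<^sub>R y - w \<in> L n" using e that by (intro subsetD[OF e(2)]) (simp add: dist_commute)
      then have "f (2 *\<^sub>R y - w) \<le> real n" by (simp add: L_def)
      moreover have "f ((1/2) *\<^sub>R (2 *\<^sub>R y - w) + (1/2) *\<^sub>R w) \<le> (1/2) * f (2 *\<^sub>R y - w) + (1/2) * f w"
        using convex_onD[OF conv, of "1/2" "2 *\<^sub>R y - w" w] by simp
      moreover have "(1/2) *\<^sub>R (2 *\<^sub>R y - w) + (1/2) *\<^sub>R w = y" by (simp add: scaleR_diff_right)
      ultimately show ?thesis by (simp add: b_def)
    qed
    have "convex_on (cball x (e/4)) f" "convex_on (ball x (e/4)) f"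
      by (auto intro: convex_on_subset[OF conv])
    then have "continuous_on (ball x (e/4)) f"
      by (intro convex_on_bounded_continuous[where b = "b + 2 * \<bar>f x\<bar>"])
         (auto intro!: convex_bounds_lemma[of x "e/4"] up)
    then show ?thesis using e(1) by (simp add: continuous_on_eq_continuous_at)
  qed
  then show ?thesis by (simp add: continuous_at_imp_continuous_on)
qed

section \<open>Measurable selections by closed convex sets\<close>

text \<open>
  Separability of a metric space passes to all its subsets: from each ball of a
  countable base that meets \<open>S\<close> one point of \<open>S\<close> is chosen.
\<close>

lemma separable_space_dense_subset:
  fixes S :: "'u::metric_space set"
  assumes "separable_space (euclidean :: 'u topology)"
  shows "\<exists>D. countable D \<and> D \<subseteq> S \<and> S \<subseteq> closure D"
proof -
  obtain E :: "'u set" where E: "countable E" "closure E = UNIV"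
    using assms by (auto simp: separable_space_def)
  define I where "I = {(e, n::nat). e \<in> E \<and> ball e (1 / Suc n) \<inter> S \<noteq> {}}"
  define h where "h = (\<lambda>(e, n::nat). SOME x. x \<in> ball e (1 / Suc n) \<inter> S)"
  have h: "h (e, n) \<in> ball e (1 / Suc n) \<inter> S" if "(e, n) \<in> I" for e n
    unfolding h_def prod.case by (rule someI_ex) (use that in \<open>auto simp: I_def\<close>)
  have "I \<subseteq> E \<times> UNIV" by (auto simp: I_def)
  then have "countable I" by (rule countable_subset) (use E(1) in blast)
  moreover have "h ` I \<subseteq> S" using h by auto
  moreover have "S \<subseteq> closure (h ` I)"
  proof
    fix x assume x: "x \<in> S"
    show "x \<in> closure (h ` I)"
      unfolding closure_approachable
    proof (intro allI impI)
      fix r :: real assume "r > 0"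
      then obtain n where n: "inverse (real (Suc n)) < r / 2" using reals_Archimedean[of "r/2"] by auto
      have "x \<in> closure E" using E(2) by simp
      then obtain e where e: "e \<in> E" "dist e x < 1 / Suc n"
        unfolding closure_approachable by (meson of_nat_0_less_iff zero_less_Suc zero_less_divide_1_iff)
      then have "(e, n) \<in> I" using x by (auto simp: I_def)
      then have "dist e (h (e, n)) < 1 / Suc n" using h by auto
      then have "dist (h (e, n)) x < r"
        using e(2) n dist_triangle3[of "h (e, n)" x e] by (simp add: inverse_eq_divide)
      with \<open>(e, n) \<in> I\<close> show "\<exists>y\<in>h ` I. dist y x < r" by blast
    qed
  qed
  ultimately show ?thesis by blast
qed

text \<open>
  The usual measurability of a set-valued map requires this for all open or all closed sets.
  Closed convex sets suffice for selections, since they include the closed balls and are stable under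
  intersection, and for them the property can be checked by convex optimization.
\<close>

definition convex_hit_measurable :: "'a measure \<Rightarrow> ('a \<Rightarrow> 'u::real_normed_vector set) \<Rightarrow> bool" where
  "convex_hit_measurable P A \<longleftrightarrow>
     (\<forall>C. closed C \<longrightarrow> convex C \<longrightarrow> {\<omega>\<in>space P. A \<omega> \<inter> C \<noteq> {}} \<in> sets P)"

text \<open>
  One step of the selection: \<open>A\<close> is cut down to the first ball of radius \<open>r\<close> around a point of the
  dense sequence that it meets.  The centre takes countably many values, each on a measurable
  set; where the centre is \<open>d j\<close>, the new map meets \<open>C\<close> if and only if \<open>A\<close> meets \<open>cball (d j) r \<inter> C\<close>.
\<close>

lemma convex_hit_measurable_refine:
  fixes A :: "'a \<Rightarrow> 'u::real_normed_vector set" and d :: "nat \<Rightarrow> 'u"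
  assumes d: "closure (range d) = UNIV"
    and A: "\<And>\<omega>. \<omega> \<in> space P \<Longrightarrow> closed (A \<omega>) \<and> A \<omega> \<noteq> {}" "convex_hit_measurable P A"
    and r: "r > 0"
  shows "\<exists>B s. (\<forall>\<omega>\<in>space P. closed (B \<omega>) \<and> B \<omega> \<noteq> {} \<and> B \<omega> \<subseteq> A \<omega> \<inter> cball (s \<omega>) r)
           \<and> convex_hit_measurable P B \<and> s \<in> borel_measurable P"
proof -
  define i where "i \<omega> = (LEAST j. A \<omega> \<inter> cball (d j) r \<noteq> {})" for \<omega>
  define B where "B \<omega> = A \<omega> \<inter> cball (d (i \<omega>)) r" for \<omega>
  have ex: "\<exists>j. A \<omega> \<inter> cball (d j) r \<noteq> {}" if \<omega>: "\<omega> \<in> space P" for \<omega>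
  proof -
    obtain a where a: "a \<in> A \<omega>" using A(1)[OF \<omega>] by blast
    have "a \<in> closure (range d)" using d by simp
    then obtain j where "dist (d j) a < r" unfolding closure_approachable using r by blast
    then have "a \<in> A \<omega> \<inter> cball (d j) r" using a by simp
    then show ?thesis by blast
  qed
  have i_hit: "A \<omega> \<inter> cball (d (i \<omega>)) r \<noteq> {}" if \<omega>: "\<omega> \<in> space P" for \<omega>
    unfolding i_def by (rule LeastI_ex[OF ex[OF \<omega>]])
  have hit: "{\<omega>\<in>space P. A \<omega> \<inter> C \<noteq> {}} \<in> sets P" if "closed C" "convex C" for C
    using A(2) that by (simp add: convex_hit_measurable_def)
  have i_meas: "i \<in> measurable P (count_space UNIV)"
    unfolding i_def by (rule measurable_Least) (use hit in \<open>simp add: pred_def\<close>)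
  have "convex_hit_measurable P B"
    unfolding convex_hit_measurable_def
  proof (intro allI impI)
    fix C :: "'u set" assume C: "closed C" "convex C"
    have "{\<omega>\<in>space P. B \<omega> \<inter> C \<noteq> {}} =
        (\<Union>j. (i -` {j} \<inter> space P) \<inter> {\<omega>\<in>space P. A \<omega> \<inter> (cball (d j) r \<inter> C) \<noteq> {}})"
      unfolding B_def Int_assoc by blast
    also have "\<dots> \<in> sets P"
    proof (rule sets.countable_UN, rule image_subsetI)
      fix j
      have "i -` {j} \<inter> space P \<in> sets P" by (rule measurable_sets[OF i_meas]) simp
      moreover have "{\<omega>\<in>space P. A \<omega> \<inter> (cball (d j) r \<inter> C) \<noteq> {}} \<in> sets P"
        using C by (intro hit closed_Int convex_Int) auto
      ultimately show "(i -` {j} \<inter> space P) \<inter> {\<omega>\<in>space P. A \<omega> \<inter> (cball (d j) r \<inter> C) \<noteq> {}} \<in> sets P"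
        by (rule sets.Int)
    qed
    finally show "{\<omega>\<in>space P. B \<omega> \<inter> C \<noteq> {}} \<in> sets P" .
  qed
  moreover have "(\<lambda>\<omega>. d (i \<omega>)) \<in> borel_measurable P"
    using i_meas by (rule measurable_compose) simp
  moreover have "\<forall>\<omega>\<in>space P. closed (B \<omega>) \<and> B \<omega> \<noteq> {} \<and> B \<omega> \<subseteq> A \<omega> \<inter> cball (d (i \<omega>)) r"
    using A(1) i_hit by (auto simp: B_def)
  ultimately show ?thesis by (intro exI[of _ B] exI[of _ "\<lambda>\<omega>. d (i \<omega>)"] conjI)
qed

text \<open>
  Refining with radii \<open>2\<^sup>-\<^sup>n\<close> gives a decreasing sequence of closed sets with diameters tending
  to \<open>0\<close>, whose common point is the pointwise limit of the measurable centres.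
\<close>

lemma convex_hit_measurable_imp_selection:
  fixes A :: "'a \<Rightarrow> 'u::banach set"
  assumes sep: "separable_space (euclidean :: 'u topology)"
    and A: "\<And>\<omega>. \<omega> \<in> space P \<Longrightarrow> closed (A \<omega>) \<and> A \<omega> \<noteq> {}" "convex_hit_measurable P A"
  shows "\<exists>\<gamma>. measurable_selection P A \<gamma>"
proof -
  obtain D :: "'u set" where D: "countable D" "UNIV \<subseteq> closure D"
    using separable_space_dense_subset[OF sep, of UNIV] by blast
  then have "D \<noteq> {}" by auto
  define d where "d = from_nat_into D"
  have d: "closure (range d) = UNIV"
    using D \<open>D \<noteq> {}\<close> by (auto simp: d_def range_from_nat_into)
  define r where "r n = (1/2 :: real) ^ n" for n
  define good where "good B \<longleftrightarrow> (\<forall>\<omega>\<in>space P. closed (B \<omega>) \<and> B \<omega> \<noteq> {}) \<and> convex_hit_measurable P B" for B :: "'a \<Rightarrow> 'u set"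
  define R where "R n B B' \<longleftrightarrow> (\<exists>s\<in>borel_measurable P. \<forall>\<omega>\<in>space P. B' \<omega> \<subseteq> B \<omega> \<inter> cball (s \<omega>) (r n))" for n and B B' :: "'a \<Rightarrow> 'u set"
  have "\<exists>f. \<forall>n. (good (f n) \<and> (n = 0 \<longrightarrow> f n = A)) \<and> R n (f n) (f (Suc n))"
  proof (rule dependent_nat_choice)
    show "\<exists>B. good B \<and> ((0::nat) = 0 \<longrightarrow> B = A)"
      using A unfolding good_def by (intro exI[of _ A]) blast
    fix B and n :: nat assume "good B \<and> (n = 0 \<longrightarrow> B = A)"
    then have B: "\<And>\<omega>. \<omega> \<in> space P \<Longrightarrow> closed (B \<omega>) \<and> B \<omega> \<noteq> {}" "convex_hit_measurable P B"
      unfolding good_def by blast+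
    have "\<exists>B' s. (\<forall>\<omega>\<in>space P. closed (B' \<omega>) \<and> B' \<omega> \<noteq> {} \<and> B' \<omega> \<subseteq> B \<omega> \<inter> cball (s \<omega>) (r n))
           \<and> convex_hit_measurable P B' \<and> s \<in> borel_measurable P"
      by (rule convex_hit_measurable_refine[OF d B]) (simp_all add: r_def)
    then obtain B' s where B': "\<forall>\<omega>\<in>space P. closed (B' \<omega>) \<and> B' \<omega> \<noteq> {} \<and> B' \<omega> \<subseteq> B \<omega> \<inter> cball (s \<omega>) (r n)"
      "convex_hit_measurable P B'" "s \<in> borel_measurable P"
      by (elim exE conjE)
    then have "good B'" by (simp add: good_def)
    moreover have "R n B B'"
      unfolding R_def by (rule bexI[OF _ B'(3)]) (use B'(1) in simp)
    ultimately show "\<exists>B'. (good B' \<and> (Suc n = 0 \<longrightarrow> B' = A)) \<and> R n B B'"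
      by (intro exI[of _ B']) simp
  qed
  then obtain f where f: "\<And>n. good (f n)" "f 0 = A" "\<And>n. R n (f n) (f (Suc n))" by blast
  obtain s where s: "\<And>n. s n \<in> borel_measurable P"
    and fs: "\<And>n \<omega>. \<omega> \<in> space P \<Longrightarrow> f (Suc n) \<omega> \<subseteq> f n \<omega> \<inter> cball (s n \<omega>) (r n)"
  proof -
    have "\<forall>n. \<exists>s. s \<in> borel_measurable P \<and> (\<forall>\<omega>\<in>space P. f (Suc n) \<omega> \<subseteq> f n \<omega> \<inter> cball (s \<omega>) (r n))"
      using f(3) unfolding R_def by blast
    then show ?thesis using that unfolding choice_iff by blast
  qed
  have "\<exists>a. \<forall>n. a \<in> f n \<omega>" if \<omega>: "\<omega> \<in> space P" for \<omega>
  proof -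
    have dec: "f n \<omega> \<subseteq> f m \<omega>" if "m \<le> n" for m n
    proof (rule lift_Suc_antimono_le[of "\<lambda>n. f n \<omega>", OF _ that])
      show "f (Suc n) \<omega> \<subseteq> f n \<omega>" for n using fs[OF \<omega>, of n] by blast
    qed
    have small: "\<exists>n. \<forall>x\<in>f n \<omega>. \<forall>y\<in>f n \<omega>. dist x y < \<epsilon>" if \<epsilon>: "\<epsilon> > 0" for \<epsilon>
    proof -
      obtain n where n: "(1/2::real) ^ n < \<epsilon> / 2" using real_arch_pow_inv[of "\<epsilon>/2" "1/2"] \<epsilon> by auto
      have "dist x y < \<epsilon>" if "x \<in> f (Suc n) \<omega>" "y \<in> f (Suc n) \<omega>" for x y
      proof -
        have "dist (s n \<omega>) x \<le> r n" "dist (s n \<omega>) y \<le> r n" using fs[OF \<omega>, of n] that by auto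
        then show ?thesis using n dist_triangle3[of x y "s n \<omega>"] by (simp add: r_def)
      qed
      then show ?thesis by blast
    qed
    show ?thesis
    proof (rule decreasing_closed_nest[of "\<lambda>n. f n \<omega>"])
      show "closed (f n \<omega>)" "f n \<omega> \<noteq> {}" for n
        using f(1)[of n] \<omega> by (simp_all add: good_def)
      show "\<exists>n. \<forall>x\<in>f n \<omega>. \<forall>y\<in>f n \<omega>. dist x y < \<epsilon>" if "\<epsilon> > 0" for \<epsilon>
        by (rule small[OF that])
    qed (rule dec, assumption, blast)
  qed
  then have "\<forall>\<omega>\<in>space P. \<exists>a. \<forall>n. a \<in> f n \<omega>" by blast
  then obtain \<gamma> where "\<forall>\<omega>\<in>space P. \<forall>n. \<gamma> \<omega> \<in> f n \<omega>" by (rule bchoice[THEN exE])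
  then have \<gamma>: "\<gamma> \<omega> \<in> f n \<omega>" if "\<omega> \<in> space P" for \<omega> n using that by blast
  have "(\<lambda>n. s n \<omega>) \<longlonglongrightarrow> \<gamma> \<omega>" if \<omega>: "\<omega> \<in> space P" for \<omega>
  proof (rule metric_LIMSEQ_I)
    fix e :: real assume "e > 0"
    then obtain N where N: "(1/2::real) ^ N < e" using real_arch_pow_inv[of e "1/2"] by auto
    have "dist (s n \<omega>) (\<gamma> \<omega>) < e" if "n \<ge> N" for n
    proof -
      have "dist (s n \<omega>) (\<gamma> \<omega>) \<le> r n" using fs[OF \<omega>, of n] \<gamma>[OF \<omega>, of "Suc n"] by auto
      also have "\<dots> \<le> r N" unfolding r_def using that by (intro power_decreasing) auto
      finally show ?thesis using N by (simp add: r_def)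
    qed
    then show "\<exists>N. \<forall>n\<ge>N. dist (s n \<omega>) (\<gamma> \<omega>) < e" by blast
  qed
  then have "\<gamma> \<in> borel_measurable P" by (rule borel_measurable_LIMSEQ_metric[OF s])
  then show ?thesis using \<gamma>[of _ 0] f(2) unfolding measurable_selection_def by auto
qed

section \<open>Measurable selection of minimizers\<close>

lemma mem_argmin_on: "x \<in> argmin_on S f \<longleftrightarrow> x \<in> S \<and> (\<forall>y\<in>S. f x \<le> f y)"
  by (auto simp: argmin_on_def is_arg_min_def not_less)

lemma coercive_on_bounded_sublevel:
  assumes "coercive_on S f"
  shows "bounded {x\<in>S. f x \<le> b}"
proof -
  have "eventually (\<lambda>x. b < f x) (inf at_infinity (principal S))"
    using assms by (simp add: coercive_on_def filterlim_at_top_dense)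
  then obtain B where B: "\<And>x. norm x \<ge> B \<Longrightarrow> x \<in> S \<Longrightarrow> b < f x"
    by (auto simp: eventually_inf_principal eventually_at_infinity)
  have "norm x \<le> B" if "x \<in> {x\<in>S. f x \<le> b}" for x
    using B[of x] that by force
  then show ?thesis by (auto simp: bounded_iff)
qed

text \<open>
  If \<open>C\<close> meets \<open>S\<close>, the minimizers over \<open>S\<close> meet \<open>C\<close> exactly when the infimum of \<open>F \<omega>\<close> over \<open>C \<inter> S\<close> does not
  exceed the infimum over \<open>S\<close>; this equivalence needs that the former is attained.  With dense
  sequences in both sets it becomes a countable combination of inequalities between
  measurable functions.
\<close>

lemma argmin_measurable_selection:
  fixes F :: "'a \<Rightarrow> 'u::banach \<Rightarrow> real"
  assumes refl: "reflexive_space TYPE('u)"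
    and sep: "separable_space (euclidean :: 'u topology)"
    and S: "closed S" "convex S" "S \<noteq> {}"
    and conv: "\<And>\<omega>. \<omega> \<in> space P \<Longrightarrow> convex_on UNIV (F \<omega>)"
    and cont: "\<And>\<omega>. \<omega> \<in> space P \<Longrightarrow> continuous_on UNIV (F \<omega>)"
    and coer: "\<And>\<omega>. \<omega> \<in> space P \<Longrightarrow> coercive_on S (F \<omega>)"
    and meas: "\<And>v. v \<in> S \<Longrightarrow> (\<lambda>\<omega>. F \<omega> v) \<in> borel_measurable P"
  shows "\<exists>\<gamma>. measurable_selection P (\<lambda>\<omega>. argmin_on S (F \<omega>)) \<gamma>"
proof (rule convex_hit_measurable_imp_selection[OF sep])
  have attained: "\<exists>x\<in>C. \<forall>y\<in>C. F \<omega> x \<le> F \<omega> y"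
    if \<omega>: "\<omega> \<in> space P" and C: "closed C" "convex C" "C \<noteq> {}" "C \<subseteq> S" for \<omega> C
  proof (rule convex_coercive_attains_inf[OF refl C(1-3) conv[OF \<omega>] cont[OF \<omega>]])
    show "bounded {x\<in>C. F \<omega> x \<le> b}" for b
      by (rule bounded_subset[OF coercive_on_bounded_sublevel[OF coer[OF \<omega>], of b]]) (use C(4) in auto)
  qed
  have approx: "\<exists>e\<in>E. F \<omega> e < c"
    if \<omega>: "\<omega> \<in> space P" and "x \<in> closure E" "F \<omega> x < c" for \<omega> x E c
  proof -
    have "open {v. F \<omega> v < c}" using cont[OF \<omega>] by (intro open_Collect_less) auto
    then show ?thesis using that open_Int_closure_eq_empty[of "{v. F \<omega> v < c}" E] by blast
  qed
  show "closed (argmin_on S (F \<omega>)) \<and> argmin_on S (F \<omega>) \<noteq> {}" if \<omega>: "\<omega> \<in> space P" for \<omega>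
  proof
    have "argmin_on S (F \<omega>) = S \<inter> (\<Inter>y\<in>S. {x. F \<omega> x \<le> F \<omega> y})" by (auto simp: mem_argmin_on)
    also have "closed \<dots>"
      using S(1) cont[OF \<omega>] by (intro closed_Int closed_INT ballI closed_Collect_le continuous_on_const)
    finally show "closed (argmin_on S (F \<omega>))" .
    show "argmin_on S (F \<omega>) \<noteq> {}" using attained[OF \<omega> S] mem_argmin_on[of _ S "F \<omega>"] by auto
  qed
  obtain D where D: "countable D" "D \<subseteq> S" "S \<subseteq> closure D"
    using separable_space_dense_subset[OF sep] by blast
  show "convex_hit_measurable P (\<lambda>\<omega>. argmin_on S (F \<omega>))"
    unfolding convex_hit_measurable_def
  proof (intro allI impI)
    fix C :: "'u set" assume C: "closed C" "convex C"
    show "{\<omega>\<in>space P. argmin_on S (F \<omega>) \<inter> C \<noteq> {}} \<in> sets P"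
    proof (cases "C \<inter> S = {}")
      case True
      then have "{\<omega>\<in>space P. argmin_on S (F \<omega>) \<inter> C \<noteq> {}} = {}" by (auto simp: mem_argmin_on)
      then show ?thesis by (simp only: sets.empty_sets)
    next
      case False
      obtain E where E: "countable E" "E \<subseteq> C \<inter> S" "C \<inter> S \<subseteq> closure E"
        using separable_space_dense_subset[OF sep] by blast
      have "argmin_on S (F \<omega>) \<inter> C \<noteq> {} \<longleftrightarrow>
          (\<forall>d\<in>D. \<forall>n. \<exists>e\<in>E. F \<omega> e < F \<omega> d + 1 / real (Suc n))"
        if \<omega>: "\<omega> \<in> space P" for \<omega>
      proof
        assume "argmin_on S (F \<omega>) \<inter> C \<noteq> {}"
        then obtain x where x: "x \<in> C" "x \<in> S" "\<forall>y\<in>S. F \<omega> x \<le> F \<omega> y"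
          by (auto simp: mem_argmin_on)
        show "\<forall>d\<in>D. \<forall>n. \<exists>e\<in>E. F \<omega> e < F \<omega> d + 1 / real (Suc n)"
        proof (intro ballI allI)
          fix d n assume "d \<in> D"
          then have "F \<omega> x \<le> F \<omega> d" using D(2) x(3) by auto
          then have "F \<omega> x < F \<omega> d + 1 / real (Suc n)" by (rule le_less_trans) simp
          then show "\<exists>e\<in>E. F \<omega> e < F \<omega> d + 1 / real (Suc n)"
            using x(1,2) E(3) by (intro approx[OF \<omega>, of x]) auto
        qed
      next
        assume R: "\<forall>d\<in>D. \<forall>n. \<exists>e\<in>E. F \<omega> e < F \<omega> d + 1 / real (Suc n)"
        obtain x where x: "x \<in> C \<inter> S" "\<forall>y\<in>C \<inter> S. F \<omega> x \<le> F \<omega> y"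
          using attained[OF \<omega>, of "C \<inter> S"] C S False by (auto simp: closed_Int convex_Int)
        have x_le: "F \<omega> x \<le> F \<omega> d" if d: "d \<in> D" for d
        proof (rule field_le_epsilon)
          fix \<eta> :: real assume "\<eta> > 0"
          then obtain n where n: "1 / real (Suc n) < \<eta>" using nat_approx_posE by blast
          obtain e where e: "e \<in> E" "F \<omega> e < F \<omega> d + 1 / real (Suc n)" using R d by blast
          have "F \<omega> x \<le> F \<omega> e" using x(2) e(1) E(2) by auto
          with e(2) n show "F \<omega> x \<le> F \<omega> d + \<eta>" by simp
        qed
        have "F \<omega> x \<le> F \<omega> y" if y: "y \<in> S" for y
        proof (rule ccontr)
          assume "\<not> ?thesis"
          then obtain d where "d \<in> D" "F \<omega> d < F \<omega> x"
            using approx[OF \<omega>, of y D "F \<omega> x"] y D(3) by auto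
          with x_le show False by force
        qed
        then have "x \<in> argmin_on S (F \<omega>)" using x(1) by (simp add: mem_argmin_on)
        then show "argmin_on S (F \<omega>) \<inter> C \<noteq> {}" using x(1) by blast
      qed
      then have "{\<omega>\<in>space P. argmin_on S (F \<omega>) \<inter> C \<noteq> {}} =
          {\<omega>\<in>space P. \<forall>d\<in>D. \<forall>n. \<exists>e\<in>E. F \<omega> e < F \<omega> d + 1 / real (Suc n)}"
        by (intro Collect_cong conj_cong HOL.refl)
      also have "\<dots> \<in> sets P"
      proof (intro sets.sets_Collect_countable_All'[OF _ D(1)] sets.sets_Collect_countable_All
            sets.sets_Collect_countable_Ex'[OF _ E(1)])
        fix d n e assume "d \<in> D" "e \<in> E"
        then have [measurable]: "(\<lambda>\<omega>. F \<omega> d) \<in> borel_measurable P" "(\<lambda>\<omega>. F \<omega> e) \<in> borel_measurable P"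
          using D(2) E(2) by (auto intro!: meas)
        show "{\<omega>\<in>space P. F \<omega> e < F \<omega> d + 1 / real (Suc n)} \<in> sets P" by measurable
      qed
      finally show ?thesis .
    qed
  qed
qed

section \<open>Measurability of the objective and the recursion\<close>

lemma has_gateaux_derivative_gradient:
  assumes "\<exists>g. has_gateaux_derivative f g u"
  shows "has_gateaux_derivative f (gateaux_gradient f u) u"
  unfolding gateaux_gradient_def
proof (rule theI')
  show "\<exists>!g. has_gateaux_derivative f g u"
  proof (rule ex_ex1I[OF assms])
    fix g h assume "has_gateaux_derivative f g u" "has_gateaux_derivative f h u"
    then show "g = h"
      unfolding has_gateaux_derivative_def by (intro blinfun_eqI) (meson LIM_unique)
  qed
qed

text \<open>
  Only pairings with a fixed direction are needed.  They are limits of difference quotients, and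
  this avoids asking whether the gradient is a Borel map into the dual.
\<close>

lemma gateaux_gradient_pairing_measurable:
  fixes K :: "'u::real_normed_vector \<Rightarrow> real"
  assumes K: "continuous_on UNIV K" and U: "U \<in> borel_measurable P"
    and diff: "\<And>\<omega>. \<omega> \<in> space P \<Longrightarrow> \<exists>g. has_gateaux_derivative K g (U \<omega>)"
  shows "(\<lambda>\<omega>. blinfun_apply (gateaux_gradient K (U \<omega>)) v) \<in> borel_measurable P"
proof (rule borel_measurable_LIMSEQ_real)
  let ?t = "\<lambda>n. 1 / real (Suc n)"
  let ?Q = "\<lambda>n u. (K (u + ?t n *\<^sub>R v) - K u) / ?t n"
  fix n
  have "continuous_on UNIV (?Q n)"
    by (intro continuous_intros continuous_on_compose2[OF K]) auto
  then have "?Q n \<in> borel_measurable borel" by (rule borel_measurable_continuous_onI)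
  then show "(\<lambda>\<omega>. ?Q n (U \<omega>)) \<in> borel_measurable P" by (rule measurable_compose[OF U])
next
  let ?t = "\<lambda>n. 1 / real (Suc n)"
  fix \<omega> assume \<omega>: "\<omega> \<in> space P"
  have "((\<lambda>t. (K (U \<omega> + t *\<^sub>R v) - K (U \<omega>)) / t) \<longlongrightarrow> blinfun_apply (gateaux_gradient K (U \<omega>)) v) (at 0)"
    using has_gateaux_derivative_gradient[OF diff[OF \<omega>]] by (simp add: has_gateaux_derivative_def)
  moreover have "filterlim ?t (at 0) sequentially"
    using LIMSEQ_Suc[OF lim_1_over_n] by (intro filterlim_atI) auto
  ultimately show "(\<lambda>n. (K (U \<omega> + ?t n *\<^sub>R v) - K (U \<omega>)) / ?t n) \<longlonglongrightarrow> blinfun_apply (gateaux_gradient K (U \<omega>)) v"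
    by (rule filterlim_compose)
qed

lemma blinfun_pairing_measurable:
  assumes "G \<in> borel_measurable P"
  shows "(\<lambda>\<omega>. blinfun_apply (G \<omega>) v) \<in> borel_measurable P"
proof -
  have "continuous_on UNIV (\<lambda>g. blinfun_apply g v)" by (intro continuous_intros)
  then show ?thesis
    by (rule measurable_compose[OF assms borel_measurable_continuous_onI])
qed

lemma lower_semicontinuous_measurable:
  fixes f :: "'a::topological_space \<Rightarrow> real"
  assumes "lower_semicontinuous f"
  shows "f \<in> borel_measurable borel"
  unfolding borel_measurable_iff_greater using lower_semicontinuous_open_superlevel[OF assms] by simp

lemma lower_semicontinuous_slices:
  assumes "lower_semicontinuous (\<lambda>(u, w). f u w)"
  shows "lower_semicontinuous (\<lambda>u. f u w)" "lower_semicontinuous (f u)"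
  unfolding lower_semicontinuous_def
proof safe
  have ev: "eventually (\<lambda>p. c < f (fst p) (snd p)) (nhds (u, w))" if "c < f u w" for u w c
    using assms that by (auto simp: lower_semicontinuous_def case_prod_beta)
  show "eventually (\<lambda>y. c < f y w) (nhds u)" if "c < f u w" for u c
  proof -
    have "filterlim (\<lambda>y. (y, w)) (nhds (u, w)) (nhds u)" by (intro tendsto_intros filterlim_ident)
    from eventually_compose_filterlim[OF ev[OF that] this] show ?thesis by simp
  qed
  show "eventually (\<lambda>y. c < f u y) (nhds w)" if "c < f u w" for w c
  proof -
    have "filterlim (\<lambda>y. (u, y)) (nhds (u, w)) (nhds w)" by (intro tendsto_intros filterlim_ident)
    from eventually_compose_filterlim[OF ev[OF that] this] show ?thesis by simp
  qed
qed

theorem theorem3p27: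
  fixes P :: "'a measure"
    and Uad :: "'u::banach set"
    and jC jS :: "'u \<Rightarrow> 'w::topological_real_vector \<Rightarrow> real"
    and K :: "'u \<Rightarrow> real"
    and W :: "nat \<Rightarrow> 'a \<Rightarrow> 'w"
    and R :: "nat \<Rightarrow> 'a \<Rightarrow> ('u \<Rightarrow>\<^sub>L real)"
    and \<epsilon> :: "nat \<Rightarrow> real"
    and u0 :: 'u
    and M :: "nat \<Rightarrow> 'a \<Rightarrow> 'u set"
    and U :: "nat \<Rightarrow> 'a \<Rightarrow> 'u"
    and G :: "nat \<Rightarrow> 'a \<Rightarrow> ('u \<Rightarrow>\<^sub>L real)"
  assumes reflexive: "reflexive_space TYPE('u)"
    and separable: "separable_space (euclidean :: 'u topology)"
    and prob: "prob_space P"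
    and complete: "complete_measure P"
    and Uad: "Uad \<noteq> {}" "closed Uad" "convex Uad"
    and jC_lsc: "lower_semicontinuous (\<lambda>(u, w). jC u w)"
    and jS_lsc: "lower_semicontinuous (\<lambda>(u, w). jS u w)"
    and jC_proper: "\<And>w. proper_fun (\<lambda>u. ereal (jC u w))"
    and jS_proper: "\<And>w. proper_fun (\<lambda>u. ereal (jS u w))"
    and jC_convex: "\<And>w. convex_on UNIV (\<lambda>u. jC u w)"
    and jS_convex: "\<And>w. convex_on UNIV (\<lambda>u. jS u w)"
    and jC_subdiff: "\<And>w. \<exists>V. open V \<and> Uad \<subseteq> V \<and>
                         (\<forall>u\<in>V. subdifferential (\<lambda>u'. jC u' w) u \<noteq> {})"
    and K_proper: "proper_fun (\<lambda>u. ereal (K u))"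
    and K_convex: "convex_on UNIV K"
    and K_lsc: "lower_semicontinuous K"
    and K_gateaux: "\<exists>V. open V \<and> Uad \<subseteq> V \<and> (\<forall>u\<in>V. \<exists>g. has_gateaux_derivative K g u)"
    and W_meas: "\<And>k. k \<ge> 1 \<Longrightarrow> W k \<in> borel_measurable P"
    and W_indep: "prob_space.indep_vars P (\<lambda>_. borel) W {1..}"
    and W_ident: "\<And>k. k \<ge> 1 \<Longrightarrow> distr P borel (W k) = distr P borel (W 1)"
    and R_meas: "\<And>k. R k \<in> borel_measurable P"
    and eps_pos: "\<And>k. \<epsilon> k > 0"
    and u0: "u0 \<in> Uad"
    \<comment> \<open>The data of step \<open>k\<close> are constrained only if \<open>M k\<close> has a measurable selection.\<close>
    and M_0: "\<And>\<omega>. \<omega> \<in> space P \<Longrightarrow> M 0 \<omega> = {u0}"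
    and U_sel: "\<And>k. \<exists>\<gamma>. measurable_selection P (M k) \<gamma> \<Longrightarrow>
                  measurable_selection P (M k) (U k)"
    and G_sel: "\<And>k. measurable_selection P (M k) (U k) \<Longrightarrow>
                  measurable_selection P
                    (\<lambda>\<omega>. subdifferential (\<lambda>u. jC u (W (Suc k) \<omega>)) (U k \<omega>)) (G k)"
    and M_Suc: "\<And>k \<omega>. measurable_selection P (M k) (U k) \<Longrightarrow> \<omega> \<in> space P \<Longrightarrow>
                  M (Suc k) \<omega> = argmin_on Uad
                    (app_objective K jS (\<epsilon> k) (U k \<omega>) (G k \<omega>) (R k \<omega>) (W (Suc k) \<omega>))"
    and coercive: "\<And>k \<omega>. measurable_selection P (M k) (U k) \<Longrightarrow> \<omega> \<in> space P \<Longrightarrow>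
                  coercive_on Uad
                    (app_objective K jS (\<epsilon> k) (U k \<omega>) (G k \<omega>) (R k \<omega>) (W (Suc k) \<omega>))"
  shows "\<forall>k. \<exists>\<gamma>. measurable_selection P (M k) \<gamma>"
proof
  have K_cont: "continuous_on UNIV K"
    by (rule convex_lower_semicontinuous_imp_continuous[OF K_convex K_lsc])
  have jS_cont: "continuous_on UNIV (\<lambda>u. jS u w)" for w
    by (rule convex_lower_semicontinuous_imp_continuous[OF jS_convex lower_semicontinuous_slices(1)[OF jS_lsc]])
  fix k
  \<comment> \<open>Feasibility is carried along because \<open>K\<close> is known to be differentiable only near \<open>Uad\<close>.\<close>
  have "(\<exists>\<gamma>. measurable_selection P (M k) \<gamma>) \<and> (\<forall>\<omega>\<in>space P. M k \<omega> \<subseteq> Uad)"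
  proof (induction k)
    case 0
    have "measurable_selection P (M 0) (\<lambda>_. u0)" by (simp add: measurable_selection_def M_0)
    then show ?case using M_0 u0 by auto
  next
    case (Suc k)
    then have sel: "measurable_selection P (M k) (U k)" using U_sel by blast
    then have U: "U k \<in> borel_measurable P" "\<And>\<omega>. \<omega> \<in> space P \<Longrightarrow> U k \<omega> \<in> Uad"
      using Suc by (auto simp: measurable_selection_def)
    have G: "G k \<in> borel_measurable P" using G_sel[OF sel] by (simp add: measurable_selection_def)
    let ?F = "\<lambda>\<omega>. app_objective K jS (\<epsilon> k) (U k \<omega>) (G k \<omega>) (R k \<omega>) (W (Suc k) \<omega>)"
    have "\<exists>\<gamma>. measurable_selection P (\<lambda>\<omega>. argmin_on Uad (?F \<omega>)) \<gamma>"
    proof (rule argmin_measurable_selection[OF reflexive separable Uad(2,3,1)])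
      fix \<omega> assume \<omega>: "\<omega> \<in> space P"
      have lin: "convex_on UNIV (blinfun_apply h)" for h :: "'u \<Rightarrow>\<^sub>L real"
        by (auto simp: convex_on_def blinfun.add_right blinfun.scaleR_right)
      show "convex_on UNIV (?F \<omega>)"
        unfolding app_objective_def using eps_pos[of k]
        by (intro convex_on_add convex_on_cmul K_convex jS_convex lin) simp
      show "continuous_on UNIV (?F \<omega>)"
        unfolding app_objective_def by (intro continuous_intros K_cont jS_cont)
      show "coercive_on Uad (?F \<omega>)" by (rule coercive[OF sel \<omega>])
    next
      fix v assume "v \<in> Uad"
      have [measurable]: "(\<lambda>\<omega>. blinfun_apply (gateaux_gradient K (U k \<omega>)) v) \<in> borel_measurable P"
        using K_gateaux U by (intro gateaux_gradient_pairing_measurable[OF K_cont U(1)]) blast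
      have [measurable]: "(\<lambda>\<omega>. blinfun_apply (G k \<omega>) v) \<in> borel_measurable P"
        "(\<lambda>\<omega>. blinfun_apply (R k \<omega>) v) \<in> borel_measurable P"
        by (rule blinfun_pairing_measurable[OF G], rule blinfun_pairing_measurable[OF R_meas])
      have [measurable]: "(\<lambda>\<omega>. jS v (W (Suc k) \<omega>)) \<in> borel_measurable P"
        using W_meas[of "Suc k"] lower_semicontinuous_measurable[OF lower_semicontinuous_slices(2)[OF jS_lsc]]
        by (intro measurable_compose[of "W (Suc k)" P borel "jS v"]) auto
      show "(\<lambda>\<omega>. ?F \<omega> v) \<in> borel_measurable P"
        unfolding app_objective_def blinfun.diff_left blinfun.add_left blinfun.scaleR_left by measurable
    qed
    moreover have "M (Suc k) \<omega> = argmin_on Uad (?F \<omega>)" if "\<omega> \<in> space P" for \<omega>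
      by (rule M_Suc[OF sel that])
    ultimately show ?case by (auto simp: measurable_selection_def mem_argmin_on)
  qed
  then show "\<exists>\<gamma>. measurable_selection P (M k) \<gamma>" by blast
qed

end
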